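(* Let $\lambda=(\lambda_1^{m_1},\ldots,\lambda_r^{m_r})$ be a partition, where $0<\lambda_1<\cdots<\lambda_r$ are integers and $m_1,\ldots,m_r$ are positive integers. Then $$R_\lambda(E)=\{(a_{ij})\in M_\lambda(E)\mid a_{jj}\in R_{\lambda_j}^{m_j}(E)\text{ for } j=1,\ldots,r\}$$ is the radical of $M_\lambda(E)$.
   Context: $K$ is a perfect field, $p(t)\in K[t]$ is irreducible, and $E=K[t]/p(t)$. The notation $\lambda=(\lambda_1^{m_1},\ldots,\lambda_r^{m_r})$ means the part $\lambda_i$ occurs $m_i$ times. Put $E_{\lambda_j}^{m_j}=E[t]/(t^{\lambda_j})^{\oplus m_j}$, $E_\lambda=E_{\lambda_1}^{m_1}\oplus\cdots\oplus E_{\lambda_r}^{m_r}$ (an $E[t]$-module), and $M_\lambda(E)=\mathrm{End}_{E[t]}(E_\lambda)$. An element $a\in M_\lambda(E)$ is written as a block matrix $a=(a_{ij})_{1\le i,j\le r}$ with $a_{ij}\in\mathrm{Hom}_{E[t]}(E_{\lambda_j}^{m_j},E_{\lambda_i}^{m_i})$. $R_{\lambda_j}^{m_j}(E)$ denotes the kernel of reduction modulo $t$, $\mathrm{End}_{E[t]}(E_{\lambda_j}^{m_j})\to \mathrm{End}_E(E^{m_j})$, i.e. the set of endomorphisms of $E_{\lambda_j}^{m_j}$ whose image lies in $tE_{\lambda_j}^{m_j}$. The radical of a finite dimensional algebra is the intersection of its maximal left ideals. *)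

theory Defs
  imports "HOL-Algebra.Algebra"
begin

definition perfect_field :: "('a, 'b) ring_scheme \<Rightarrow> bool"
  where "perfect_field K \<longleftrightarrow> field K \<and>
    (\<forall>q::nat. Factorial_Ring.prime q \<longrightarrow> [q] \<cdot>\<^bsub>K\<^esub> \<one>\<^bsub>K\<^esub> = \<zero>\<^bsub>K\<^esub> \<longrightarrow>
      (\<lambda>x. x [^]\<^bsub>K\<^esub> q) ` carrier K = carrier K)"

locale left_ideal = additive_subgroup I R + ring R for I and R (structure) +
  assumes l_closed: "\<lbrakk>a \<in> I; x \<in> carrier R\<rbrakk> \<Longrightarrow> x \<otimes> a \<in> I"

locale maximal_left_ideal = left_ideal +
  assumes proper: "I \<noteq> carrier R"
    and maximal: "\<lbrakk>left_ideal J R; I \<subseteq> J\<rbrakk> \<Longrightarrow> J = I \<or> J = carrier R"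

text \<open>The intersection with the carrier only matters for the zero ring, which has no maximal
  left ideals.\<close>

definition radical :: "('a, 'b) ring_scheme \<Rightarrow> 'a set"
  where "radical A = carrier A \<inter> \<Inter>{I. maximal_left_ideal I A}"

definition quotient_module :: "('a, 'b) ring_scheme \<Rightarrow> 'a set \<Rightarrow> ('a, 'a set) module"
  where "quotient_module R I =
    \<lparr>carrier = carrier (R Quot I), monoid.mult = monoid.mult (R Quot I), one = \<one>\<^bsub>R Quot I\<^esub>,
     ring.zero = \<zero>\<^bsub>R Quot I\<^esub>, ring.add = ring.add (R Quot I),
     smult = (\<lambda>a x. (I +>\<^bsub>R\<^esub> a) \<otimes>\<^bsub>R Quot I\<^esub> x)\<rparr>"

text \<open>The library's module records extend ring records; the fields \<open>mult\<close> and \<open>one\<close> play no role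
  in the module structure and are filled componentwise.  The index set is meant to be finite.\<close>

definition direct_sum :: "'i set \<Rightarrow> ('i \<Rightarrow> ('a, 'b, 'c) module_scheme) \<Rightarrow> ('a, 'i \<Rightarrow> 'b) module"
  where "direct_sum S N =
    \<lparr>carrier = (\<Pi>\<^sub>E i\<in>S. carrier (N i)),
     monoid.mult = (\<lambda>x y. \<lambda>i\<in>S. x i \<otimes>\<^bsub>N i\<^esub> y i), one = (\<lambda>i\<in>S. \<one>\<^bsub>N i\<^esub>),
     ring.zero = (\<lambda>i\<in>S. \<zero>\<^bsub>N i\<^esub>), ring.add = (\<lambda>x y. \<lambda>i\<in>S. x i \<oplus>\<^bsub>N i\<^esub> y i),
     smult = (\<lambda>a x. \<lambda>i\<in>S. a \<odot>\<^bsub>N i\<^esub> x i)\<rparr>"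

definition sum_inj :: "'i set \<Rightarrow> ('i \<Rightarrow> ('a, 'b, 'c) module_scheme) \<Rightarrow> 'i \<Rightarrow> 'b \<Rightarrow> 'i \<Rightarrow> 'b"
  where "sum_inj S N j x = (\<lambda>i\<in>S. if i = j then x else \<zero>\<^bsub>N i\<^esub>)"

text \<open>The block \<open>a\<^sub>i\<^sub>j : N\<^sub>j \<rightarrow> N\<^sub>i\<close> of an endomorphism \<open>a\<close> of a direct sum.\<close>

definition block ::
  "'i set \<Rightarrow> ('i \<Rightarrow> ('a, 'b, 'c) module_scheme) \<Rightarrow> (('i \<Rightarrow> 'b) \<Rightarrow> ('i \<Rightarrow> 'b)) \<Rightarrow> 'i \<Rightarrow> 'i \<Rightarrow> 'b \<Rightarrow> 'b"
  where "block S N a i j = (\<lambda>x\<in>carrier (N j). a (sum_inj S N j x) i)"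

definition module_End ::
  "('a, 'd) ring_scheme \<Rightarrow> ('a, 'b, 'c) module_scheme \<Rightarrow> ('b \<Rightarrow> 'b) ring"
  where "module_End R N =
    \<lparr>carrier = {f \<in> carrier N \<rightarrow>\<^sub>E carrier N.
       (\<forall>x\<in>carrier N. \<forall>y\<in>carrier N. f (x \<oplus>\<^bsub>N\<^esub> y) = f x \<oplus>\<^bsub>N\<^esub> f y) \<and>
       (\<forall>c\<in>carrier R. \<forall>x\<in>carrier N. f (c \<odot>\<^bsub>N\<^esub> x) = c \<odot>\<^bsub>N\<^esub> f x)},
     monoid.mult = (\<lambda>f g. compose (carrier N) f g), one = (\<lambda>x\<in>carrier N. x),
     ring.zero = (\<lambda>x\<in>carrier N. \<zero>\<^bsub>N\<^esub>), ring.add = (\<lambda>f g. \<lambda>x\<in>carrier N. f x \<oplus>\<^bsub>N\<^esub> g x)\<rparr>"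

text \<open>\<open>E_pow E n k\<close> is the \<open>E[t]\<close>-module \<open>(E[t]/(t\<^sup>n))\<^sup>k\<close>.\<close>

definition E_pow ::
  "('a, 'b) ring_scheme \<Rightarrow> nat \<Rightarrow> nat \<Rightarrow> ('a list, nat \<Rightarrow> 'a list set) module"
  where "E_pow E n k = direct_sum {1..k}
    (\<lambda>_. quotient_module (poly_ring E) (PIdl\<^bsub>poly_ring E\<^esub> (X\<^bsub>E\<^esub> [^]\<^bsub>poly_ring E\<^esub> n)))"

text \<open>The endomorphisms of \<open>N = (E[t]/(t\<^sup>n))\<^sup>k\<close> with image in \<open>t N\<close>, i.e. those inducing zero on
  \<open>N / t N = E\<^sup>k\<close>: the kernel of reduction modulo \<open>t\<close>.\<close>

definition R_pow ::
  "('a, 'b) ring_scheme \<Rightarrow> nat \<Rightarrow> nat \<Rightarrow> ((nat \<Rightarrow> 'a list set) \<Rightarrow> (nat \<Rightarrow> 'a list set)) set"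
  where "R_pow E n k =
    {b \<in> carrier (module_End (poly_ring E) (E_pow E n k)).
       b ` carrier (E_pow E n k) \<subseteq> (\<lambda>x. X\<^bsub>E\<^esub> \<odot>\<^bsub>E_pow E n k\<^esub> x) ` carrier (E_pow E n k)}"

text \<open>The partition having \<open>m j\<close> parts equal to \<open>l j\<close>, for \<open>j = 1, \<dots>, r\<close>, is given by \<open>r\<close>, \<open>l\<close>
  and \<open>m\<close>; values of \<open>l\<close> and \<open>m\<close> outside \<open>{1..r}\<close> are irrelevant.\<close>

definition E_part ::
  "('a, 'b) ring_scheme \<Rightarrow> nat \<Rightarrow> (nat \<Rightarrow> nat) \<Rightarrow> (nat \<Rightarrow> nat) \<Rightarrow>
    ('a list, nat \<Rightarrow> nat \<Rightarrow> 'a list set) module"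
  where "E_part E r l m = direct_sum {1..r} (\<lambda>j. E_pow E (l j) (m j))"

definition M_part ::
  "('a, 'b) ring_scheme \<Rightarrow> nat \<Rightarrow> (nat \<Rightarrow> nat) \<Rightarrow> (nat \<Rightarrow> nat) \<Rightarrow>
    ((nat \<Rightarrow> nat \<Rightarrow> 'a list set) \<Rightarrow> (nat \<Rightarrow> nat \<Rightarrow> 'a list set)) ring"
  where "M_part E r l m = module_End (poly_ring E) (E_part E r l m)"

definition R_part ::
  "('a, 'b) ring_scheme \<Rightarrow> nat \<Rightarrow> (nat \<Rightarrow> nat) \<Rightarrow> (nat \<Rightarrow> nat) \<Rightarrow>
    ((nat \<Rightarrow> nat \<Rightarrow> 'a list set) \<Rightarrow> (nat \<Rightarrow> nat \<Rightarrow> 'a list set)) set"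
  where "R_part E r l m =
    {a \<in> carrier (M_part E r l m). \<forall>j\<in>{1..r}.
       block {1..r} (\<lambda>j. E_pow E (l j) (m j)) a j j \<in> R_pow E (l j) (m j)}"

end

(* Write l = l_j.  For x in E_lambda with t^l x = 0, the component x_j lies in t E_{l_j}^{m_j} exactly
   when t^(l-1) x lies in t^l E_lambda, a condition that every endomorphism preserves.  So R_lambda is
   the intersection of the left ideals I(j,x) = {a | t^(l-1) a(x) in t^l E_lambda} over j and x in
   E_{l_j}^{m_j}.  Each of these is maximal or everything: an element of E_{l_j}^{m_j} outside
   t E_{l_j}^{m_j} can be mapped to x by an endomorphism.  Hence R_lambda contains the radical.
   Conversely, an element of R_lambda moves the socle elements of t^h E_lambda into t^(h+1) E_lambda,
   hence is nilpotent, and a left ideal of nilpotent elements lies in every maximal left ideal. *)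

theory Submission
  imports Defs
begin

section \<open>Direct sums and endomorphism rings\<close>

text \<open>The obstacle is the product of block matrices: the diagonal block of ab is the sum over
  i of a_ji b_ij, and membership in R_lambda puts no condition on off-diagonal blocks. Their
  composites still land in t E_{l_j}^{m_j} because the parts are distinct. That fact enters through
  the intrinsic description of t-divisibility of a component, so that no matrix product and no
  quotient algebra has to be computed.

  The ideal I(j,x) is the annihilator of the class of x in the simple module E^{m_j} = E_{l_j}^{m_j}
  / t E_{l_j}^{m_j}; this is why it is maximal as soon as it is proper.

  Nilpotence cannot be read off from the powers of t on all of E_lambda. For lambda = (1,2) the
  projection E[t]/(t^2) -> E[t]/(t) lies in R_lambda, but its image is not in t E_lambda. On the
  socle the difficulty disappears, since a socle element of E_{l_j}^{m_j} is already a multiple of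
  t^(l_j - 1). From the socle one climbs through the kernels of t^k.\<close>

definition scal_image :: "('a, 'b, 'c) module_scheme \<Rightarrow> 'a \<Rightarrow> 'b set"
  where "scal_image N c = (\<lambda>x. c \<odot>\<^bsub>N\<^esub> x) ` carrier N"

lemma direct_sum_simps:
  "carrier (direct_sum S N) = (\<Pi>\<^sub>E i\<in>S. carrier (N i))"
  "\<zero>\<^bsub>direct_sum S N\<^esub> = (\<lambda>i\<in>S. \<zero>\<^bsub>N i\<^esub>)"
  "x \<oplus>\<^bsub>direct_sum S N\<^esub> y = (\<lambda>i\<in>S. x i \<oplus>\<^bsub>N i\<^esub> y i)"
  "c \<odot>\<^bsub>direct_sum S N\<^esub> x = (\<lambda>i\<in>S. c \<odot>\<^bsub>N i\<^esub> x i)"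
  by (simp_all add: direct_sum_def)

lemma direct_sum_eqI:
  assumes "x \<in> carrier (direct_sum S N)" "y \<in> carrier (direct_sum S N)"
    and "\<And>i. i \<in> S \<Longrightarrow> x i = y i"
  shows "x = y"
  using assms by (auto simp: direct_sum_simps intro: PiE_ext)

lemma direct_sum_mem: "x \<in> carrier (direct_sum S N) \<Longrightarrow> i \<in> S \<Longrightarrow> x i \<in> carrier (N i)"
  by (auto simp: direct_sum_simps)

lemma direct_sum_extensional: "x \<in> carrier (direct_sum S N) \<Longrightarrow> x \<in> extensional S"
  by (auto simp: direct_sum_simps PiE_def)

lemma direct_sum_module:
  assumes P: "cring P" and N: "\<And>i. i \<in> S \<Longrightarrow> module P (N i)"
  shows "module P (direct_sum S N)"
proof (rule moduleI)
  have ag: "abelian_group (N i)" if "i \<in> S" for i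
    using N[OF that] by (simp add: module_def)
  note mem = direct_sum_mem
  note abm = abelian_group.axioms(1)[OF ag]
  show "abelian_group (direct_sum S N)"
  proof (rule abelian_groupI)
    fix x y assume x: "x \<in> carrier (direct_sum S N)" and y: "y \<in> carrier (direct_sum S N)"
    show "x \<oplus>\<^bsub>direct_sum S N\<^esub> y \<in> carrier (direct_sum S N)"
      using mem[OF x] mem[OF y] abelian_monoid.a_closed[OF abm] by (auto simp: direct_sum_simps)
    show "x \<oplus>\<^bsub>direct_sum S N\<^esub> y = y \<oplus>\<^bsub>direct_sum S N\<^esub> x"
      unfolding direct_sum_simps
      by (rule restrict_ext) (metis mem x y abelian_monoid.a_comm[OF abm])
  next
    show "\<zero>\<^bsub>direct_sum S N\<^esub> \<in> carrier (direct_sum S N)"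
      using abelian_monoid.zero_closed[OF abm] by (auto simp: direct_sum_simps)
  next
    fix x y z assume x: "x \<in> carrier (direct_sum S N)" and y: "y \<in> carrier (direct_sum S N)"
      and z: "z \<in> carrier (direct_sum S N)"
    show "x \<oplus>\<^bsub>direct_sum S N\<^esub> y \<oplus>\<^bsub>direct_sum S N\<^esub> z = x \<oplus>\<^bsub>direct_sum S N\<^esub> (y \<oplus>\<^bsub>direct_sum S N\<^esub> z)"
      unfolding direct_sum_simps
      by (rule restrict_ext) (use mem[OF x] mem[OF y] mem[OF z] abelian_monoid.a_assoc[OF abm] in simp)
  next
    fix x assume x: "x \<in> carrier (direct_sum S N)"
    have "(\<lambda>i\<in>S. \<zero>\<^bsub>N i\<^esub> \<oplus>\<^bsub>N i\<^esub> x i) = (\<lambda>i\<in>S. x i)"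
      by (rule restrict_ext) (use mem[OF x] abelian_monoid.l_zero[OF abm] in simp)
    also have "\<dots> = x" using x by (auto simp: direct_sum_simps PiE_restrict)
    finally show "\<zero>\<^bsub>direct_sum S N\<^esub> \<oplus>\<^bsub>direct_sum S N\<^esub> x = x"
      by (simp add: direct_sum_simps cong: restrict_cong)
    have "(\<lambda>i\<in>S. \<ominus>\<^bsub>N i\<^esub> x i) \<in> carrier (direct_sum S N)"
      using mem[OF x] abelian_group.a_inv_closed[OF ag] by (auto simp: direct_sum_simps)
    moreover have "(\<lambda>i\<in>S. \<ominus>\<^bsub>N i\<^esub> x i) \<oplus>\<^bsub>direct_sum S N\<^esub> x = \<zero>\<^bsub>direct_sum S N\<^esub>"
      unfolding direct_sum_simps
      by (rule restrict_ext) (use mem[OF x] abelian_group.l_neg[OF ag] in simp)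
    ultimately show "\<exists>y\<in>carrier (direct_sum S N). y \<oplus>\<^bsub>direct_sum S N\<^esub> x = \<zero>\<^bsub>direct_sum S N\<^esub>"
      by blast
  qed
  fix a b x y
  assume a: "a \<in> carrier P" and b: "b \<in> carrier P"
    and x: "x \<in> carrier (direct_sum S N)" and y: "y \<in> carrier (direct_sum S N)"
  show "a \<odot>\<^bsub>direct_sum S N\<^esub> x \<in> carrier (direct_sum S N)"
    using a mem[OF x] module.smult_closed[OF N] by (auto simp: direct_sum_simps)
  show "(a \<oplus>\<^bsub>P\<^esub> b) \<odot>\<^bsub>direct_sum S N\<^esub> x
      = a \<odot>\<^bsub>direct_sum S N\<^esub> x \<oplus>\<^bsub>direct_sum S N\<^esub> b \<odot>\<^bsub>direct_sum S N\<^esub> x"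
    unfolding direct_sum_simps
    by (rule restrict_ext) (use a b mem[OF x] module.smult_l_distr[OF N] in simp)
  show "a \<odot>\<^bsub>direct_sum S N\<^esub> (x \<oplus>\<^bsub>direct_sum S N\<^esub> y)
      = a \<odot>\<^bsub>direct_sum S N\<^esub> x \<oplus>\<^bsub>direct_sum S N\<^esub> a \<odot>\<^bsub>direct_sum S N\<^esub> y"
    unfolding direct_sum_simps
    by (rule restrict_ext) (use a mem[OF x] mem[OF y] module.smult_r_distr[OF N] in simp)
  show "(a \<otimes>\<^bsub>P\<^esub> b) \<odot>\<^bsub>direct_sum S N\<^esub> x = a \<odot>\<^bsub>direct_sum S N\<^esub> (b \<odot>\<^bsub>direct_sum S N\<^esub> x)"
    unfolding direct_sum_simps
    by (rule restrict_ext) (use a b mem[OF x] module.smult_assoc1[OF N] in simp)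
next
  fix x assume x: "x \<in> carrier (direct_sum S N)"
  have "(\<lambda>i\<in>S. \<one>\<^bsub>P\<^esub> \<odot>\<^bsub>N i\<^esub> x i) = (\<lambda>i\<in>S. x i)"
    by (rule restrict_ext) (use direct_sum_mem[OF x] module.smult_one[OF N] in simp)
  also have "\<dots> = x" using x by (auto simp: direct_sum_simps PiE_restrict)
  finally show "\<one>\<^bsub>P\<^esub> \<odot>\<^bsub>direct_sum S N\<^esub> x = x"
    by (simp add: direct_sum_simps)
qed (rule P)

lemma scal_image_direct_sum:
  "x \<in> scal_image (direct_sum S N) c \<longleftrightarrow>
    x \<in> extensional S \<and> (\<forall>i\<in>S. x i \<in> scal_image (N i) c)"
proof
  assume "x \<in> scal_image (direct_sum S N) c"
  then show "x \<in> extensional S \<and> (\<forall>i\<in>S. x i \<in> scal_image (N i) c)"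
    by (auto simp: scal_image_def direct_sum_simps)
next
  assume *: "x \<in> extensional S \<and> (\<forall>i\<in>S. x i \<in> scal_image (N i) c)"
  then have "\<forall>i\<in>S. \<exists>y. y \<in> carrier (N i) \<and> x i = c \<odot>\<^bsub>N i\<^esub> y"
    by (auto simp: scal_image_def)
  then obtain y where "\<forall>i\<in>S. y i \<in> carrier (N i) \<and> x i = c \<odot>\<^bsub>N i\<^esub> y i"
    by metis
  with * have "x = c \<odot>\<^bsub>direct_sum S N\<^esub> restrict y S" "restrict y S \<in> carrier (direct_sum S N)"
    by (auto simp: direct_sum_simps intro: extensionalityI[of _ S])
  then show "x \<in> scal_image (direct_sum S N) c"
    by (auto simp: scal_image_def)
qed

lemma sum_inj_closed:
  assumes "\<And>i. i \<in> S \<Longrightarrow> module P (N i)" "x \<in> carrier (N j)"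
  shows "sum_inj S N j x \<in> carrier (direct_sum S N)"
  using assms abelian_monoid.zero_closed[OF abelian_group.axioms(1)[OF module.axioms(2)[OF assms(1)]]]
  by (auto simp: sum_inj_def direct_sum_simps)

lemma sum_inj_add:
  assumes N: "\<And>i. i \<in> S \<Longrightarrow> module P (N i)" and x: "x \<in> carrier (N j)" and y: "y \<in> carrier (N j)"
  shows "sum_inj S N j (x \<oplus>\<^bsub>N j\<^esub> y) = sum_inj S N j x \<oplus>\<^bsub>direct_sum S N\<^esub> sum_inj S N j y"
proof -
  note abm = abelian_group.axioms(1)[OF module.axioms(2)[OF N]]
  show ?thesis
    unfolding sum_inj_def direct_sum_simps
    by (rule restrict_ext) (use x y abelian_monoid.zero_closed[OF abm] abelian_monoid.r_zero[OF abm] in auto)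
qed

lemma sum_inj_smult:
  assumes N: "\<And>i. i \<in> S \<Longrightarrow> module P (N i)" and x: "x \<in> carrier (N j)" and c: "c \<in> carrier P"
  shows "sum_inj S N j (c \<odot>\<^bsub>N j\<^esub> x) = c \<odot>\<^bsub>direct_sum S N\<^esub> sum_inj S N j x"
  unfolding sum_inj_def direct_sum_simps
  by (rule restrict_ext) (use x c module.smult_r_null[OF N] in auto)

text \<open>Replaces the decomposition of \<open>y\<close> into the finite sum of its components.\<close>

lemma direct_sum_mem_by_components:
  assumes N: "\<And>i. i \<in> S \<Longrightarrow> module P (N i)" and "finite S" and y: "y \<in> carrier (direct_sum S N)"
    and zero: "\<zero>\<^bsub>direct_sum S N\<^esub> \<in> W"
    and add: "\<And>u v. u \<in> W \<Longrightarrow> v \<in> W \<Longrightarrow> u \<oplus>\<^bsub>direct_sum S N\<^esub> v \<in> W"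
    and comp: "\<And>j. j \<in> S \<Longrightarrow> sum_inj S N j (y j) \<in> W"
  shows "y \<in> W"
proof -
  note abm = abelian_group.axioms(1)[OF module.axioms(2)[OF N]]
  have "(\<lambda>i\<in>S. if i \<in> T then y i else \<zero>\<^bsub>N i\<^esub>) \<in> W" if "finite T" "T \<subseteq> S" for T
    using that
  proof (induction T rule: finite_induct)
    case empty
    then show ?case using zero by (simp add: direct_sum_simps del: restrict_apply)
  next
    case (insert j T)
    have "(\<lambda>i\<in>S. if i \<in> insert j T then y i else \<zero>\<^bsub>N i\<^esub>)
        = sum_inj S N j (y j) \<oplus>\<^bsub>direct_sum S N\<^esub> (\<lambda>i\<in>S. if i \<in> T then y i else \<zero>\<^bsub>N i\<^esub>)"
      unfolding sum_inj_def direct_sum_simps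
      by (rule restrict_ext) (use insert direct_sum_mem[OF y] abelian_monoid.zero_closed[OF abm]
          abelian_monoid.r_zero[OF abm] abelian_monoid.l_zero[OF abm] in auto)
    with insert comp add show ?case by (auto simp del: restrict_apply)
  qed
  from this[OF \<open>finite S\<close>] have "restrict y S \<in> W" by (auto cong: restrict_cong)
  then show ?thesis using y by (simp add: direct_sum_simps PiE_restrict)
qed

section \<open>The endomorphism ring of a module\<close>

lemma module_End_simps:
  "\<zero>\<^bsub>module_End R N\<^esub> = (\<lambda>x\<in>carrier N. \<zero>\<^bsub>N\<^esub>)"
  "\<one>\<^bsub>module_End R N\<^esub> = (\<lambda>x\<in>carrier N. x)"
  "f \<oplus>\<^bsub>module_End R N\<^esub> g = (\<lambda>x\<in>carrier N. f x \<oplus>\<^bsub>N\<^esub> g x)"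
  "f \<otimes>\<^bsub>module_End R N\<^esub> g = (\<lambda>x\<in>carrier N. f (g x))"
  by (simp_all add: module_End_def compose_def)

lemma module_EndI:
  assumes "f \<in> extensional (carrier N)"
    and "\<And>x. x \<in> carrier N \<Longrightarrow> f x \<in> carrier N"
    and "\<And>x y. x \<in> carrier N \<Longrightarrow> y \<in> carrier N \<Longrightarrow> f (x \<oplus>\<^bsub>N\<^esub> y) = f x \<oplus>\<^bsub>N\<^esub> f y"
    and "\<And>c x. c \<in> carrier R \<Longrightarrow> x \<in> carrier N \<Longrightarrow> f (c \<odot>\<^bsub>N\<^esub> x) = c \<odot>\<^bsub>N\<^esub> f x"
  shows "f \<in> carrier (module_End R N)"
  using assms by (auto simp: module_End_def PiE_def)

lemma module_EndD:
  assumes "f \<in> carrier (module_End R N)"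
  shows "f \<in> extensional (carrier N)"
    and "\<And>x. x \<in> carrier N \<Longrightarrow> f x \<in> carrier N"
    and "\<And>x y. x \<in> carrier N \<Longrightarrow> y \<in> carrier N \<Longrightarrow> f (x \<oplus>\<^bsub>N\<^esub> y) = f x \<oplus>\<^bsub>N\<^esub> f y"
    and "\<And>c x. c \<in> carrier R \<Longrightarrow> x \<in> carrier N \<Longrightarrow> f (c \<odot>\<^bsub>N\<^esub> x) = c \<odot>\<^bsub>N\<^esub> f x"
  using assms by (auto simp: module_End_def PiE_def)

lemma (in module) module_End_ring: "ring (module_End R M)"
proof -
  let ?A = "module_End R M"
  have eqI: "f = g" if "f \<in> carrier ?A" "g \<in> carrier ?A" "\<And>x. x \<in> carrier M \<Longrightarrow> f x = g x" for f g
    using that by (auto intro: extensionalityI[OF module_EndD(1) module_EndD(1)])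
  have add: "f \<oplus>\<^bsub>?A\<^esub> g \<in> carrier ?A" if "f \<in> carrier ?A" "g \<in> carrier ?A" for f g
    using module_EndD[OF that(1)] module_EndD[OF that(2)]
    by (intro module_EndI) (auto simp: module_End_simps smult_r_distr M.a_ac)
  have mult: "f \<otimes>\<^bsub>?A\<^esub> g \<in> carrier ?A" if "f \<in> carrier ?A" "g \<in> carrier ?A" for f g
    using module_EndD[OF that(1)] module_EndD[OF that(2)]
    by (intro module_EndI) (auto simp: module_End_simps)
  have zero: "\<zero>\<^bsub>?A\<^esub> \<in> carrier ?A"
    by (intro module_EndI) (auto simp: module_End_simps)
  have one: "\<one>\<^bsub>?A\<^esub> \<in> carrier ?A"
    by (intro module_EndI) (auto simp: module_End_simps)
  show ?thesis
  proof (rule ringI)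
    show "abelian_group ?A"
    proof (rule abelian_groupI)
      fix f g h assume f: "f \<in> carrier ?A" and g: "g \<in> carrier ?A" and h: "h \<in> carrier ?A"
      show "f \<oplus>\<^bsub>?A\<^esub> g \<oplus>\<^bsub>?A\<^esub> h = f \<oplus>\<^bsub>?A\<^esub> (g \<oplus>\<^bsub>?A\<^esub> h)"
        by (rule eqI) (use f g h in \<open>auto simp: add, auto simp: module_End_simps M.a_assoc module_EndD\<close>)
      show "f \<oplus>\<^bsub>?A\<^esub> g = g \<oplus>\<^bsub>?A\<^esub> f"
        by (rule eqI) (use f g in \<open>auto simp: add, auto simp: module_End_simps M.a_comm module_EndD\<close>)
    next
      fix f assume f: "f \<in> carrier ?A"
      show "\<zero>\<^bsub>?A\<^esub> \<oplus>\<^bsub>?A\<^esub> f = f"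
        by (rule eqI) (use f in \<open>auto simp: add zero, auto simp: module_End_simps module_EndD\<close>)
      have "(\<lambda>x\<in>carrier M. \<ominus>\<^bsub>M\<^esub> f x) \<in> carrier ?A"
        using module_EndD[OF f]
        by (intro module_EndI) (auto simp: M.minus_add smult_r_minus)
      moreover from this have "(\<lambda>x\<in>carrier M. \<ominus>\<^bsub>M\<^esub> f x) \<oplus>\<^bsub>?A\<^esub> f = \<zero>\<^bsub>?A\<^esub>"
        by (intro eqI) (use f in \<open>auto simp: add zero, auto simp: module_End_simps module_EndD M.l_neg\<close>)
      ultimately show "\<exists>g\<in>carrier ?A. g \<oplus>\<^bsub>?A\<^esub> f = \<zero>\<^bsub>?A\<^esub>" by blast
    qed (simp_all add: add zero)
    show "monoid ?A"
    proof (rule monoidI)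
      fix f g h assume f: "f \<in> carrier ?A" and g: "g \<in> carrier ?A" and h: "h \<in> carrier ?A"
      show "f \<otimes>\<^bsub>?A\<^esub> g \<otimes>\<^bsub>?A\<^esub> h = f \<otimes>\<^bsub>?A\<^esub> (g \<otimes>\<^bsub>?A\<^esub> h)"
        by (rule eqI) (use f g h in \<open>auto simp: mult, auto simp: module_End_simps module_EndD\<close>)
    next
      fix f assume f: "f \<in> carrier ?A"
      show "\<one>\<^bsub>?A\<^esub> \<otimes>\<^bsub>?A\<^esub> f = f"
        by (rule eqI) (use f in \<open>auto simp: mult one, auto simp: module_End_simps module_EndD\<close>)
      show "f \<otimes>\<^bsub>?A\<^esub> \<one>\<^bsub>?A\<^esub> = f"
        by (rule eqI) (use f in \<open>auto simp: mult one, auto simp: module_End_simps module_EndD\<close>)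
    qed (simp_all add: mult one)
    fix f g h assume f: "f \<in> carrier ?A" and g: "g \<in> carrier ?A" and h: "h \<in> carrier ?A"
    show "(f \<oplus>\<^bsub>?A\<^esub> g) \<otimes>\<^bsub>?A\<^esub> h = f \<otimes>\<^bsub>?A\<^esub> h \<oplus>\<^bsub>?A\<^esub> g \<otimes>\<^bsub>?A\<^esub> h"
      by (rule eqI) (use f g h in \<open>auto simp: mult add, auto simp: module_End_simps module_EndD\<close>)
    show "h \<otimes>\<^bsub>?A\<^esub> (f \<oplus>\<^bsub>?A\<^esub> g) = h \<otimes>\<^bsub>?A\<^esub> f \<oplus>\<^bsub>?A\<^esub> h \<otimes>\<^bsub>?A\<^esub> g"
      by (rule eqI) (use f g h in \<open>auto simp: mult add, auto simp: module_End_simps module_EndD\<close>)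
  qed
qed

section \<open>Left ideals and the radical\<close>

lemma (in ring) left_idealI:
  assumes sub: "I \<subseteq> carrier R" and zero: "\<zero> \<in> I"
    and add: "\<And>a b. a \<in> I \<Longrightarrow> b \<in> I \<Longrightarrow> a \<oplus> b \<in> I"
    and mult: "\<And>a x. a \<in> I \<Longrightarrow> x \<in> carrier R \<Longrightarrow> x \<otimes> a \<in> I"
  shows "left_ideal I R"
proof -
  \<comment> \<open>Negation is left multiplication by -1, so \<open>mult\<close> already provides
    it.\<close>
  have "\<ominus> a \<in> I" if "a \<in> I" for a
    using mult[OF that, of "\<ominus> \<one>"] that sub by (auto simp: l_minus)
  then have "subgroup I (add_monoid R)"
    using assms by unfold_locales (auto simp: a_inv_def[symmetric])
  then show ?thesis
    using mult by (intro left_ideal.intro left_ideal_axioms.intro additive_subgroupI ring_axioms)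
qed

lemma (in left_ideal) eq_carrierI: "\<one> \<in> I \<Longrightarrow> I = carrier R"
  using l_closed[of \<one>] a_Hcarr by force

text \<open>The condition \<open>inv\<close> expresses simplicity of the quotient module R/I: every
  nonzero class generates the class of 1. A larger left ideal J contains such a b, hence also
  1.\<close>

lemma maximal_left_idealI:
  fixes R (structure)
  assumes I: "left_ideal I R" and proper: "I \<noteq> carrier R"
    and inv: "\<And>b. b \<in> carrier R \<Longrightarrow> b \<notin> I \<Longrightarrow> \<exists>c\<in>carrier R. \<one> \<ominus> c \<otimes> b \<in> I"
  shows "maximal_left_ideal I R"
proof (intro maximal_left_ideal.intro maximal_left_ideal_axioms.intro I proper)
  fix J assume J: "left_ideal J R" "I \<subseteq> J"
  interpret J: left_ideal J R by fact
  show "J = I \<or> J = carrier R"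
  proof (cases "J \<subseteq> I")
    case False
    then obtain b where b: "b \<in> J" "b \<notin> I" by blast
    then obtain c where c: "c \<in> carrier R" "\<one> \<ominus> c \<otimes> b \<in> I"
      using inv J.a_Hcarr by blast
    have "(\<one> \<ominus> c \<otimes> b) \<oplus> c \<otimes> b \<in> J"
      using J(2) b c J.l_closed J.a_closed by blast
    also have "(\<one> \<ominus> c \<otimes> b) \<oplus> c \<otimes> b = \<one>"
      using b(1) c(1) J.a_Hcarr by (simp add: a_minus_def J.a_assoc J.l_neg)
    finally show ?thesis using J.eq_carrierI by blast
  qed (use J in blast)
qed

text \<open>If \<open>a\<close> lay outside a maximal left ideal \<open>I\<close>, then \<open>1 \<in> I + L\<close>, so \<open>1 - b \<in> I\<close> for some
  \<open>b \<in> L\<close>; as \<open>b\<close> is nilpotent, \<open>1 \<in> I\<close>.\<close>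

lemma nil_left_ideal_subset_radical:
  fixes R (structure)
  assumes L: "left_ideal L R" and nil: "\<And>a. a \<in> L \<Longrightarrow> \<exists>n::nat. a [^] n = \<zero>"
  shows "L \<subseteq> radical R"
proof -
  interpret L: left_ideal L R by fact
  have "L \<subseteq> I" if max: "maximal_left_ideal I R" for I
  proof (rule ccontr)
    assume not_sub: "\<not> L \<subseteq> I"
    interpret I: maximal_left_ideal I R by fact
    define J where "J = {x \<oplus> y |x y. x \<in> I \<and> y \<in> L}"
    have J_I: "x \<oplus> y \<in> J" if "x \<in> I" "y \<in> L" for x y
      using that by (auto simp: J_def)
    have J_E: thesis if "z \<in> J" "\<And>x y. z = x \<oplus> y \<Longrightarrow> x \<in> I \<Longrightarrow> y \<in> L \<Longrightarrow> thesis" for z thesis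
      using that by (auto simp: J_def)
    note carr = I.a_Hcarr L.a_Hcarr
    note I_sub = additive_subgroup.zero_closed[OF I.additive_subgroup_axioms]
      additive_subgroup.a_closed[OF I.additive_subgroup_axioms]
    note L_sub = additive_subgroup.zero_closed[OF L.additive_subgroup_axioms]
      additive_subgroup.a_closed[OF L.additive_subgroup_axioms]
    have "left_ideal J R"
    proof (rule L.left_idealI)
      show "J \<subseteq> carrier R"
        using carr by (auto elim!: J_E)
      show "\<zero> \<in> J"
        using J_I[OF I_sub(1) L_sub(1)] by simp
    next
      fix a b assume "a \<in> J" "b \<in> J"
      then obtain x y x' y' where ab: "a = x \<oplus> y" "b = x' \<oplus> y'"
        and *: "x \<in> I" "x' \<in> I" "y \<in> L" "y' \<in> L"
        by (elim J_E) blast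
      have "a \<oplus> b = (x \<oplus> x') \<oplus> (y \<oplus> y')"
        using * unfolding ab by (simp add: carr L.add.m_ac)
      also have "\<dots> \<in> J"
        using * by (intro J_I I_sub(2) L_sub(2))
      finally show "a \<oplus> b \<in> J" .
    next
      fix a z assume a: "a \<in> J" and z: "z \<in> carrier R"
      then obtain x y where a_eq: "a = x \<oplus> y" and *: "x \<in> I" "y \<in> L"
        by (elim J_E) blast
      have "z \<otimes> a = z \<otimes> x \<oplus> z \<otimes> y"
        using * z unfolding a_eq by (simp add: carr L.r_distr)
      also have "\<dots> \<in> J"
        using * z by (intro J_I I.l_closed L.l_closed)
      finally show "z \<otimes> a \<in> J" .
    qed
    moreover have "I \<subseteq> J"
      using J_I[OF _ L_sub(1)] carr by force
    moreover have "L \<subseteq> J"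
      using J_I[OF I_sub(1)] carr by force
    ultimately have "\<one> \<in> J" using I.maximal[of J] not_sub L.one_closed by blast
    then obtain x b where eq: "\<one> = x \<oplus> b" and x: "x \<in> I" and b: "b \<in> L"
      by (rule J_E)
    have xc: "x \<in> carrier R" and bc: "b \<in> carrier R" using x b carr by blast+
    \<comment> \<open>Multiplying 1 = x + b by b^n on the left gives b^n = b^n x + b^(n+1), and b^n
      x lies in I. The element y built this way is the geometric sum (1 + b + ... + b^(n-1))
      x.\<close>
    have "\<exists>y\<in>I. y \<oplus> b [^] n = \<one>" for n :: nat
    proof (induction n)
      case 0
      show ?case using I_sub(1) by (intro bexI[of _ \<zero>]) simp_all
    next
      case (Suc n)
      then obtain y where y: "y \<in> I" "y \<oplus> b [^] n = \<one>" by blast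
      have yc: "y \<in> carrier R" using y(1) carr by blast
      have "(y \<oplus> b [^] n \<otimes> x) \<oplus> b [^] Suc n = y \<oplus> b [^] n \<otimes> (x \<oplus> b)"
        using yc xc bc by (simp add: L.a_assoc L.r_distr)
      also have "\<dots> = \<one>"
        using bc y(2) by (simp add: eq[symmetric])
      finally show ?case
        using y(1) x bc by (intro bexI[of _ "y \<oplus> b [^] n \<otimes> x"] I_sub(2) I.l_closed) simp_all
    qed
    moreover obtain n :: nat where n: "b [^] n = \<zero>" using nil[OF b] by blast
    ultimately obtain y where "y \<in> I" "y \<oplus> b [^] n = \<one>" by blast
    then have "\<one> \<in> I" using carr n by simp
    then show False using I.eq_carrierI I.proper by blast
  qed
  then show ?thesis unfolding radical_def using L.a_subset by blast
qed


section \<open>Multiples of a scalar in a module\<close>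

context module
begin

lemma scal_image_add:
  assumes "c \<in> carrier R" "x \<in> scal_image M c" "y \<in> scal_image M c"
  shows "x \<oplus>\<^bsub>M\<^esub> y \<in> scal_image M c"
proof -
  obtain u v where uv: "u \<in> carrier M" "v \<in> carrier M" and "x = c \<odot>\<^bsub>M\<^esub> u" "y = c \<odot>\<^bsub>M\<^esub> v"
    using assms by (auto simp: scal_image_def)
  then have "x \<oplus>\<^bsub>M\<^esub> y = c \<odot>\<^bsub>M\<^esub> (u \<oplus>\<^bsub>M\<^esub> v)"
    using assms(1) by (simp add: smult_r_distr)
  with uv show ?thesis by (auto simp: scal_image_def)
qed

lemma scal_image_zero: "c \<in> carrier R \<Longrightarrow> \<zero>\<^bsub>M\<^esub> \<in> scal_image M c"
  unfolding scal_image_def by (rule image_eqI[of _ _ "\<zero>\<^bsub>M\<^esub>"]) simp_all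

lemma scal_image_End:
  assumes "c \<in> carrier R" "f \<in> carrier (module_End R M)" "x \<in> scal_image M c"
  shows "f x \<in> scal_image M c"
  using assms module_EndD(2,4)[OF assms(2)] by (auto simp: scal_image_def)

lemma scal_image_mono:
  assumes "c \<in> carrier R" "d \<in> carrier R"
  shows "scal_image M (c \<otimes> d) \<subseteq> scal_image M c"
  using assms by (auto simp: scal_image_def smult_assoc1)

lemma scal_image_pow_mono:
  assumes "c \<in> carrier R" "m \<le> (n::nat)"
  shows "scal_image M (c [^] n) \<subseteq> scal_image M (c [^] m)"
proof -
  have "c [^] n = c [^] m \<otimes> c [^] (n - m)"
    using assms by (simp add: R.nat_pow_mult)
  then show ?thesis using scal_image_mono[of "c [^] m" "c [^] (n - m)"] assms by simp
qed

lemma End_zero: "f \<in> carrier (module_End R M) \<Longrightarrow> f \<zero>\<^bsub>M\<^esub> = \<zero>\<^bsub>M\<^esub>"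
  using module_EndD(2)[of f R M "\<zero>\<^bsub>M\<^esub>"] module_EndD(4)[of f R M \<zero> "\<zero>\<^bsub>M\<^esub>"] by simp

text \<open>Negatives in the endomorphism ring are given only abstractly, as inverses in its
  additive group. Evaluating f = (f - g) + g at x and cancelling g x avoids a pointwise formula for
  them.\<close>

lemma End_minus:
  assumes f: "f \<in> carrier (module_End R M)" and g: "g \<in> carrier (module_End R M)"
    and x: "x \<in> carrier M" and eq: "f x = g x"
  shows "(f \<ominus>\<^bsub>module_End R M\<^esub> g) x = \<zero>\<^bsub>M\<^esub>"
proof -
  interpret A: ring "module_End R M" by (rule module_End_ring)
  have "f x = ((f \<ominus>\<^bsub>module_End R M\<^esub> g) \<oplus>\<^bsub>module_End R M\<^esub> g) x"
    using f g by (simp add: a_minus_def A.a_assoc A.l_neg)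
  also have "\<dots> = (f \<ominus>\<^bsub>module_End R M\<^esub> g) x \<oplus>\<^bsub>M\<^esub> g x"
    using x by (simp add: module_End_simps(3))
  finally show ?thesis
    using eq module_EndD(2)[OF g x] module_EndD(2)[OF A.minus_closed[OF f g] x]
    by (metis M.add.r_cancel_one')
qed

text \<open>The v with c v in d M form a submodule that every endomorphism preserves; the set in
  question is its preimage under the evaluation of endomorphisms at x.\<close>

lemma left_ideal_transporter:
  assumes c: "c \<in> carrier R" and d: "d \<in> carrier R" and x: "x \<in> carrier M"
  shows "left_ideal {a \<in> carrier (module_End R M). c \<odot>\<^bsub>M\<^esub> a x \<in> scal_image M d} (module_End R M)"
proof -
  interpret A: ring "module_End R M" by (rule module_End_ring)
  show ?thesis
  proof (rule A.left_idealI)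
    show "\<zero>\<^bsub>module_End R M\<^esub> \<in> {a \<in> carrier (module_End R M). c \<odot>\<^bsub>M\<^esub> a x \<in> scal_image M d}"
      using c d x scal_image_zero by (simp add: A.zero_closed, simp add: module_End_simps)
  next
    fix a b
    assume a: "a \<in> {a \<in> carrier (module_End R M). c \<odot>\<^bsub>M\<^esub> a x \<in> scal_image M d}"
      and b: "b \<in> {a \<in> carrier (module_End R M). c \<odot>\<^bsub>M\<^esub> a x \<in> scal_image M d}"
    then have "c \<odot>\<^bsub>M\<^esub> (a \<oplus>\<^bsub>module_End R M\<^esub> b) x = c \<odot>\<^bsub>M\<^esub> a x \<oplus>\<^bsub>M\<^esub> c \<odot>\<^bsub>M\<^esub> b x"
      using c x module_EndD(2)[of a R M x] module_EndD(2)[of b R M x]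
      by (simp add: module_End_simps(3) smult_r_distr)
    with a b show "a \<oplus>\<^bsub>module_End R M\<^esub> b \<in> {a \<in> carrier (module_End R M). c \<odot>\<^bsub>M\<^esub> a x \<in> scal_image M d}"
      using d scal_image_add by simp
  next
    fix a b
    assume a: "a \<in> {a \<in> carrier (module_End R M). c \<odot>\<^bsub>M\<^esub> a x \<in> scal_image M d}"
      and b: "b \<in> carrier (module_End R M)"
    then have "c \<odot>\<^bsub>M\<^esub> (b \<otimes>\<^bsub>module_End R M\<^esub> a) x = b (c \<odot>\<^bsub>M\<^esub> a x)"
      using c x module_EndD(2)[of a R M x] module_EndD(4)[OF b] by (simp add: module_End_simps(4))
    with a b show "b \<otimes>\<^bsub>module_End R M\<^esub> a \<in> {a \<in> carrier (module_End R M). c \<odot>\<^bsub>M\<^esub> a x \<in> scal_image M d}"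
      using d scal_image_End by simp
  qed auto
qed

end

section \<open>Direct sums of homogeneous modules\<close>

text \<open>\<open>N\<^sub>j\<close> behaves like a free module of finite rank over \<open>E[t]/(t\<^bsup>l j\<^esup>)\<close>.\<close>

locale homogeneous_sum = P: cring P for P :: "('p, 'q) ring_scheme" (structure) +
  fixes t :: 'p and S :: "'i set" and N :: "'i \<Rightarrow> ('p, 'n, 'z) module_scheme" and l :: "'i \<Rightarrow> nat"
  assumes t_closed: "t \<in> carrier P"
    and fin: "finite S"
    and N_module: "j \<in> S \<Longrightarrow> module P (N j)"
    and l_pos: "j \<in> S \<Longrightarrow> 0 < l j"
    and l_inj: "inj_on l S"
    and annihilated: "\<lbrakk>j \<in> S; y \<in> carrier (N j)\<rbrakk> \<Longrightarrow> (t [^] l j) \<odot>\<^bsub>N j\<^esub> y = \<zero>\<^bsub>N j\<^esub>"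
    and divisible: "\<lbrakk>j \<in> S; y \<in> carrier (N j); k \<le> l j; (t [^] k) \<odot>\<^bsub>N j\<^esub> y = \<zero>\<^bsub>N j\<^esub>\<rbrakk>
      \<Longrightarrow> y \<in> scal_image (N j) (t [^] (l j - k))"
    and transitive: "\<lbrakk>j \<in> S; x \<in> carrier (N j); y \<in> carrier (N j); y \<notin> scal_image (N j) t\<rbrakk>
      \<Longrightarrow> \<exists>f\<in>carrier (module_End P (N j)). f y = x"
begin

abbreviation D where "D \<equiv> direct_sum S N"
abbreviation A where "A \<equiv> module_End P D"
abbreviation inj where "inj \<equiv> sum_inj S N"

definition diag_radical where
  "diag_radical = {a \<in> carrier A. \<forall>j\<in>S. \<forall>x\<in>carrier (N j). a (inj j x) j \<in> scal_image (N j) t}"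

sublocale D: module P D
  by (rule direct_sum_module) (auto intro: N_module P.is_cring)

sublocale A: ring A
  by (rule D.module_End_ring)

lemma t_pow_closed [simp]: "t [^] (n::nat) \<in> carrier P"
  using t_closed by simp

lemma inj_closed: "x \<in> carrier (N j) \<Longrightarrow> inj j x \<in> carrier D"
  by (rule sum_inj_closed[OF N_module])

lemma inj_add:
  "\<lbrakk>x \<in> carrier (N j); y \<in> carrier (N j)\<rbrakk> \<Longrightarrow> inj j (x \<oplus>\<^bsub>N j\<^esub> y) = inj j x \<oplus>\<^bsub>D\<^esub> inj j y"
  by (rule sum_inj_add[OF N_module])

lemma inj_smult:
  "\<lbrakk>x \<in> carrier (N j); c \<in> carrier P\<rbrakk> \<Longrightarrow> inj j (c \<odot>\<^bsub>N j\<^esub> x) = c \<odot>\<^bsub>D\<^esub> inj j x"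
  by (rule sum_inj_smult[OF N_module])

lemma annihilated_add:
  assumes "j \<in> S" "y \<in> carrier (N j)" "l j \<le> n"
  shows "(t [^] n) \<odot>\<^bsub>N j\<^esub> y = \<zero>\<^bsub>N j\<^esub>"
proof -
  interpret Nj: module P "N j" using N_module assms(1) .
  have "t [^] n = t [^] (n - l j) \<otimes> t [^] l j"
    using assms t_closed by (simp add: P.nat_pow_mult)
  then show ?thesis using assms annihilated by (simp add: Nj.smult_assoc1)
qed

text \<open>The right-hand side does not mention the decomposition of \<open>D\<close>, and is preserved by every
  endomorphism.\<close>

lemma component_divisible_iff:
  assumes j: "j \<in> S" and x: "x \<in> carrier D" and tx: "(t [^] l j) \<odot>\<^bsub>D\<^esub> x = \<zero>\<^bsub>D\<^esub>"
  shows "x j \<in> scal_image (N j) t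
    \<longleftrightarrow> (t [^] (l j - 1)) \<odot>\<^bsub>D\<^esub> x \<in> scal_image D (t [^] l j)"
proof
  interpret Nj: module P "N j" using N_module j .
  have t_l: "t [^] l j = t [^] (l j - 1) \<otimes> t"
    using l_pos[OF j] by (metis One_nat_def P.nat_pow_Suc Suc_pred)
  {
    assume *: "x j \<in> scal_image (N j) t"
    have "(t [^] (l j - 1)) \<odot>\<^bsub>N i\<^esub> x i \<in> scal_image (N i) (t [^] l j)" if i: "i \<in> S" for i
    proof -
      interpret Ni: module P "N i" using N_module i .
      have xi: "x i \<in> carrier (N i)" using direct_sum_mem[OF x i] .
      have txi: "(t [^] l j) \<odot>\<^bsub>N i\<^esub> x i = \<zero>\<^bsub>N i\<^esub>"
        using fun_cong[OF tx, of i] i by (simp add: direct_sum_simps)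
      \<comment> \<open>Distinct lengths make i = j the only case of equality, which is where the
        hypothesis on x_j is used. Shorter summands are killed by t^(l j - 1); in longer ones, being
        killed by t^(l j) forces divisibility by t^(l i - l j).\<close>
      consider "l i < l j" | "i = j" | "l j < l i"
        using l_inj i j by (metis inj_onD linorder_neqE_nat)
      then show ?thesis
      proof cases
        case 1
        then have "(t [^] (l j - 1)) \<odot>\<^bsub>N i\<^esub> x i = \<zero>\<^bsub>N i\<^esub>"
          using annihilated_add i xi by simp
        then show ?thesis using Ni.scal_image_zero by simp
      next
        case 2
        with * obtain z where "z \<in> carrier (N i)" "x i = t \<odot>\<^bsub>N i\<^esub> z"
          by (auto simp: scal_image_def)
        then have "(t [^] (l j - 1)) \<odot>\<^bsub>N i\<^esub> x i = (t [^] l j) \<odot>\<^bsub>N i\<^esub> z"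
          using t_closed t_l by (simp add: Ni.smult_assoc1)
        with \<open>z \<in> _\<close> show ?thesis by (simp add: scal_image_def)
      next
        case 3
        then obtain z where z: "z \<in> carrier (N i)" "x i = (t [^] (l i - l j)) \<odot>\<^bsub>N i\<^esub> z"
          using divisible[OF i xi _ txi] by (auto simp: scal_image_def)
        have "t [^] (l j - 1) \<otimes> t [^] (l i - l j) = t [^] (l j - 1 + (l i - l j))"
          using t_closed by (simp add: P.nat_pow_mult)
        \<comment> \<open>Splits off the factor t^(l j). The truncated difference
          \<open>l i - 1 - l j\<close> is exact because l i exceeds l j.\<close>
        also have "l j - 1 + (l i - l j) = l j + (l i - 1 - l j)"
          using 3 l_pos[OF j] by simp
        also have "t [^] \<dots> = t [^] l j \<otimes> t [^] (l i - 1 - l j)"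
          using t_closed by (simp add: P.nat_pow_mult)
        finally have "(t [^] (l j - 1)) \<odot>\<^bsub>N i\<^esub> x i
            = (t [^] l j) \<odot>\<^bsub>N i\<^esub> ((t [^] (l i - 1 - l j)) \<odot>\<^bsub>N i\<^esub> z)"
          using z by (simp add: Ni.smult_assoc1[symmetric])
        then show ?thesis using z by (simp add: scal_image_def)
      qed
    qed
    then show "(t [^] (l j - 1)) \<odot>\<^bsub>D\<^esub> x \<in> scal_image D (t [^] l j)"
      by (simp add: scal_image_direct_sum) (simp add: direct_sum_simps)
  next
    assume "(t [^] (l j - 1)) \<odot>\<^bsub>D\<^esub> x \<in> scal_image D (t [^] l j)"
    then have "(t [^] (l j - 1)) \<odot>\<^bsub>N j\<^esub> x j \<in> scal_image (N j) (t [^] l j)"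
      using j by (simp add: scal_image_direct_sum) (simp add: direct_sum_simps)
    \<comment> \<open>Within N_j the multiples of t^(l j) are just 0. Divisibility with k = l j - 1
      then leaves the exponent 1.\<close>
    then have "(t [^] (l j - 1)) \<odot>\<^bsub>N j\<^esub> x j = \<zero>\<^bsub>N j\<^esub>"
      using annihilated[OF j] by (auto simp: scal_image_def)
    then show "x j \<in> scal_image (N j) t"
      using divisible[OF j direct_sum_mem[OF x j], of "l j - 1"] l_pos[OF j] t_closed by simp
  }
qed

section \<open>Maximal left ideals attached to the elements of a summand\<close>

lemma inj_image_annihilated:
  assumes "j \<in> S" "x \<in> carrier (N j)" "a \<in> carrier A"
  shows "(t [^] l j) \<odot>\<^bsub>D\<^esub> a (inj j x) = \<zero>\<^bsub>D\<^esub>"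
proof -
  interpret Nj: module P "N j" using N_module assms(1) .
  have "(t [^] l j) \<odot>\<^bsub>D\<^esub> a (inj j x) = a ((t [^] l j) \<odot>\<^bsub>D\<^esub> inj j x)"
    using module_EndD(4)[OF assms(3)] inj_closed[OF assms(2)] by simp
  also have "(t [^] l j) \<odot>\<^bsub>D\<^esub> inj j x = inj j ((t [^] l j) \<odot>\<^bsub>N j\<^esub> x)"
    using inj_smult[OF assms(2)] by simp
  also have "\<dots> = \<zero>\<^bsub>D\<^esub>"
    using annihilated[OF assms(1,2)] by (auto simp: sum_inj_def direct_sum_simps)
  finally show ?thesis using D.End_zero[OF assms(3)] by simp
qed

text \<open>Formulated by the intrinsic criterion instead of the component
  \<open>a (inj j x) j\<close>, so that it is visibly a left ideal;
  \<open>mem_point_ideal_iff\<close> translates back.\<close>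

definition point_ideal where
  "point_ideal j x = {a \<in> carrier A. (t [^] (l j - 1)) \<odot>\<^bsub>D\<^esub> a (inj j x) \<in> scal_image D (t [^] l j)}"

lemma mem_point_ideal_iff:
  assumes "j \<in> S" "x \<in> carrier (N j)" "a \<in> carrier A"
  shows "a \<in> point_ideal j x \<longleftrightarrow> a (inj j x) j \<in> scal_image (N j) t"
  using component_divisible_iff[OF assms(1) _ inj_image_annihilated[OF assms]] assms(3)
    module_EndD(2)[OF assms(3) inj_closed[OF assms(2)]]
  by (simp add: point_ideal_def)

lemma mem_diag_radical_iff:
  "a \<in> diag_radical \<longleftrightarrow> a \<in> carrier A \<and> (\<forall>j\<in>S. \<forall>x\<in>carrier (N j). a \<in> point_ideal j x)"
  using mem_point_ideal_iff by (auto simp: diag_radical_def)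

lemma left_ideal_point_ideal:
  "x \<in> carrier (N j) \<Longrightarrow> left_ideal (point_ideal j x) A"
  unfolding point_ideal_def by (rule D.left_ideal_transporter) (auto intro: inj_closed)

lemma left_ideal_diag_radical: "left_ideal diag_radical A"
proof (rule A.left_idealI)
  note I = left_ideal_point_ideal
  note sub = left_ideal.axioms(1)[OF I]
  show "diag_radical \<subseteq> carrier A" by (auto simp: diag_radical_def)
  show "\<zero>\<^bsub>A\<^esub> \<in> diag_radical"
    using additive_subgroup.zero_closed[OF sub] by (auto simp: mem_diag_radical_iff)
  show "a \<oplus>\<^bsub>A\<^esub> b \<in> diag_radical" if "a \<in> diag_radical" "b \<in> diag_radical" for a b
    using that additive_subgroup.a_closed[OF sub] by (auto simp: mem_diag_radical_iff)
  show "b \<otimes>\<^bsub>A\<^esub> a \<in> diag_radical" if "a \<in> diag_radical" "b \<in> carrier A" for a b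
    using that left_ideal.l_closed[OF I] by (auto simp: mem_diag_radical_iff)
qed

text \<open>This is the block matrix with f in position (j,j) and zeros elsewhere. It lifts an
  endomorphism supplied by \<open>transitive\<close> from one summand to the whole sum.\<close>

lemma block_extension_closed:
  assumes j: "j \<in> S" and f: "f \<in> carrier (module_End P (N j))"
  shows "(\<lambda>y\<in>carrier D. inj j (f (y j))) \<in> carrier A"
proof (rule module_EndI)
  note fD = module_EndD[OF f]
  fix x y assume x: "x \<in> carrier D" and y: "y \<in> carrier D"
  have xj: "x j \<in> carrier (N j)" and yj: "y j \<in> carrier (N j)"
    using direct_sum_mem[OF x j] direct_sum_mem[OF y j] .
  show "(\<lambda>y\<in>carrier D. inj j (f (y j))) (x \<oplus>\<^bsub>D\<^esub> y)
      = (\<lambda>y\<in>carrier D. inj j (f (y j))) x \<oplus>\<^bsub>D\<^esub> (\<lambda>y\<in>carrier D. inj j (f (y j))) y"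
    using x y j xj yj fD inj_add[OF fD(2)[OF xj] fD(2)[OF yj]]
      D.M.a_closed[OF x y] by (simp, simp add: direct_sum_simps(3))
next
  note fD = module_EndD[OF f]
  fix c x assume x: "x \<in> carrier D" and c: "c \<in> carrier P"
  have xj: "x j \<in> carrier (N j)"
    using direct_sum_mem[OF x j] .
  show "(\<lambda>y\<in>carrier D. inj j (f (y j))) (c \<odot>\<^bsub>D\<^esub> x) = c \<odot>\<^bsub>D\<^esub> (\<lambda>y\<in>carrier D. inj j (f (y j))) x"
    using x j xj fD c inj_smult[OF fD(2)[OF xj] c]
      D.smult_closed[OF c x] by (simp, simp add: direct_sum_simps(4))
next
  fix x assume "x \<in> carrier D"
  then show "(\<lambda>y\<in>carrier D. inj j (f (y j))) x \<in> carrier D"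
    using inj_closed module_EndD(2)[OF f] direct_sum_mem[of x S N j] j by simp
qed simp

lemma maximal_point_ideal:
  assumes j: "j \<in> S" and x: "x \<in> carrier (N j)" and proper: "point_ideal j x \<noteq> carrier A"
  shows "maximal_left_ideal (point_ideal j x) A"
proof (rule maximal_left_idealI[OF left_ideal_point_ideal[OF x] proper])
  fix b assume b: "b \<in> carrier A" "b \<notin> point_ideal j x"
  have bx: "b (inj j x) \<in> carrier D"
    using module_EndD(2)[OF b(1)] inj_closed x by blast
  obtain f where f: "f \<in> carrier (module_End P (N j))" "f (b (inj j x) j) = x"
    using transitive[OF j x direct_sum_mem[OF bx j]] b mem_point_ideal_iff[OF j x] by blast
  define c where "c = (\<lambda>y\<in>carrier D. inj j (f (y j)))"
  have c: "c \<in> carrier A"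
    unfolding c_def by (rule block_extension_closed[OF j f(1)])
  \<comment> \<open>The map c discards all components of b (inj j x) except the j-th and sends that
    one back to x. Agreement of c b with the identity at this single point is enough, because
    membership in the ideal depends on this value alone.\<close>
  have "(c \<otimes>\<^bsub>A\<^esub> b) (inj j x) = inj j x"
    using bx f(2) inj_closed[OF x] by (simp add: module_End_simps(4) c_def)
  then have "(\<one>\<^bsub>A\<^esub> \<ominus>\<^bsub>A\<^esub> c \<otimes>\<^bsub>A\<^esub> b) (inj j x) = \<zero>\<^bsub>D\<^esub>"
    using inj_closed[OF x] b c by (intro D.End_minus) (auto, simp add: module_End_simps(2))
  then have "\<one>\<^bsub>A\<^esub> \<ominus>\<^bsub>A\<^esub> c \<otimes>\<^bsub>A\<^esub> b \<in> point_ideal j x"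
    using b c D.scal_image_zero by (simp add: point_ideal_def)
  with c show "\<exists>c\<in>carrier A. \<one>\<^bsub>A\<^esub> \<ominus>\<^bsub>A\<^esub> c \<otimes>\<^bsub>A\<^esub> b \<in> point_ideal j x" by blast
qed

lemma radical_subset_diag_radical: "radical A \<subseteq> diag_radical"
proof
  fix a assume a: "a \<in> radical A"
  \<comment> \<open>A point ideal that is not proper, as happens for x in t N_j, is the whole ring
    and contains a anyway.\<close>
  then have "a \<in> point_ideal j x" if "j \<in> S" "x \<in> carrier (N j)" for j x
    using maximal_point_ideal[OF that] by (auto simp: radical_def)
  with a show "a \<in> diag_radical" by (auto simp: mem_diag_radical_iff radical_def)
qed

text \<open>Summands with l j \<le> h contribute nothing to t^h D. In a longer one the socle
  component is t^(l j - 1) w, which a moves into t^(l j) D, and l j \<ge> h + 1.\<close>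

lemma diag_radical_socle:
  assumes a: "a \<in> diag_radical" and y: "y \<in> scal_image D (t [^] (h::nat))"
    and ty: "t \<odot>\<^bsub>D\<^esub> y = \<zero>\<^bsub>D\<^esub>"
  shows "a y \<in> scal_image D (t [^] Suc h)"
proof -
  have aA: "a \<in> carrier A" using a by (simp add: diag_radical_def)
  have yD: "y \<in> carrier D" using y by (auto simp: scal_image_def)
  define W where "W = {u \<in> carrier D. a u \<in> scal_image D (t [^] Suc h)}"
  have "y \<in> W"
  proof (rule direct_sum_mem_by_components[OF N_module fin yD])
    show "\<zero>\<^bsub>D\<^esub> \<in> W"
      using D.scal_image_zero[OF t_pow_closed, of "Suc h"] D.End_zero[OF aA] by (simp add: W_def)
    show "u \<oplus>\<^bsub>D\<^esub> v \<in> W" if "u \<in> W" "v \<in> W" for u v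
      using that D.scal_image_add[OF t_pow_closed, of _ "Suc h"] module_EndD(3)[OF aA] by (simp add: W_def)
    fix j assume j: "j \<in> S"
    interpret Nj: module P "N j" using N_module j .
    have yj: "y j \<in> carrier (N j)" using direct_sum_mem[OF yD j] .
    show "inj j (y j) \<in> W"
    proof (cases "l j \<le> h")
      case True
      obtain z where "z \<in> carrier D" "y = (t [^] h) \<odot>\<^bsub>D\<^esub> z"
        using y by (auto simp: scal_image_def)
      then have "y j = \<zero>\<^bsub>N j\<^esub>"
        using annihilated_add[OF j _ True] j direct_sum_mem[OF _ j, of z N]
        by (simp add: direct_sum_simps(4))
      then have "inj j (y j) = \<zero>\<^bsub>D\<^esub>" by (auto simp: sum_inj_def direct_sum_simps)
      with \<open>\<zero>\<^bsub>D\<^esub> \<in> W\<close> show ?thesis by simp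
    next
      case False
      \<comment> \<open>Written with the exponent 1 so that \<open>divisible\<close> applies with k
        = 1; positivity of l j supplies 1 \<le> l j.\<close>
      have "(t [^] (1::nat)) \<odot>\<^bsub>N j\<^esub> y j = \<zero>\<^bsub>N j\<^esub>"
        using fun_cong[OF ty, of j] j t_closed by (simp add: direct_sum_simps)
      from divisible[OF j yj _ this] l_pos[OF j] obtain w
        where w: "w \<in> carrier (N j)" "y j = (t [^] (l j - 1)) \<odot>\<^bsub>N j\<^esub> w"
        by (auto simp: scal_image_def)
      have "a (inj j (y j)) = (t [^] (l j - 1)) \<odot>\<^bsub>D\<^esub> a (inj j w)"
        using w module_EndD(4)[OF aA] inj_closed[OF w(1)]
          inj_smult[OF w(1)] by simp
      \<comment> \<open>This is literally the membership of a in the point ideal of w.\<close>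
      also have "\<dots> \<in> scal_image D (t [^] l j)"
        using a w(1) j by (simp add: mem_diag_radical_iff point_ideal_def)
      also have "\<dots> \<subseteq> scal_image D (t [^] Suc h)"
        by (rule D.scal_image_pow_mono[OF t_closed]) (use False in simp)
      finally show ?thesis using inj_closed[OF yj] by (simp add: W_def)
    qed
  qed
  then show ?thesis by (simp add: W_def)
qed

text \<open>Ring powers put the new factor on the right, that is, innermost. The induction on the
  socle needs a as the outermost map.\<close>

lemma A_pow_Suc_apply:
  assumes "a \<in> carrier A" "x \<in> carrier D"
  shows "(a [^]\<^bsub>A\<^esub> Suc n) x = a ((a [^]\<^bsub>A\<^esub> n) x)"
  using assms A.nat_pow_Suc2[of a n] by (simp add: module_End_simps(4))

text \<open>Two inductions are nested. The power a^h sends the socle into t^h D, so a^L kills it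
  once t^L D = 0. Consequently a^L maps the kernel of t^(k+1) into the kernel of t^k, and L such
  steps exhaust D, giving the exponent L * L.\<close>

lemma diag_radical_nilpotent:
  assumes a: "a \<in> diag_radical"
  shows "\<exists>n::nat. a [^]\<^bsub>A\<^esub> n = \<zero>\<^bsub>A\<^esub>"
proof -
  have aA: "a \<in> carrier A" using a by (simp add: diag_radical_def)
  \<comment> \<open>Any common upper bound of the lengths would do; the sum also makes sense for
    empty S.\<close>
  define L where "L = (\<Sum>j\<in>S. l j)"
  have tL: "(t [^] L) \<odot>\<^bsub>D\<^esub> z = \<zero>\<^bsub>D\<^esub>" if z: "z \<in> carrier D" for z
  proof -
    have "l j \<le> L" if "j \<in> S" for j
      unfolding L_def using that fin by (simp add: member_le_sum)
    then show ?thesis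
      using annihilated_add direct_sum_mem[OF z] by (auto simp: direct_sum_simps)
  qed
  have powA: "a [^]\<^bsub>A\<^esub> (n::nat) \<in> carrier A" for n using aA by simp
  have socle: "(a [^]\<^bsub>A\<^esub> L) y = \<zero>\<^bsub>D\<^esub>" if y: "y \<in> carrier D" "t \<odot>\<^bsub>D\<^esub> y = \<zero>\<^bsub>D\<^esub>" for y
  proof -
    have "(a [^]\<^bsub>A\<^esub> h) y \<in> scal_image D (t [^] h)" for h :: nat
    proof (induction h)
      case 0
      show ?case using y by (force simp: module_End_simps scal_image_def)
    next
      case (Suc h)
      have "t \<odot>\<^bsub>D\<^esub> (a [^]\<^bsub>A\<^esub> h) y = \<zero>\<^bsub>D\<^esub>"
        using module_EndD(4)[OF powA t_closed y(1)] y(2) D.End_zero[OF powA] by simp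
      from diag_radical_socle[OF a Suc this] show ?case
        using A_pow_Suc_apply[OF aA y(1)] by simp
    qed
    from this[of L] show ?thesis using tL by (auto simp: scal_image_def)
  qed
  have "(a [^]\<^bsub>A\<^esub> (k * L)) x = \<zero>\<^bsub>D\<^esub>"
    if "x \<in> carrier D" "(t [^] k) \<odot>\<^bsub>D\<^esub> x = \<zero>\<^bsub>D\<^esub>" for k x
    using that
  proof (induction k arbitrary: x)
    case 0
    then show ?case by (simp add: module_End_simps)
  next
    case (Suc k)
    let ?x = "(a [^]\<^bsub>A\<^esub> L) x"
    have x': "?x \<in> carrier D" using module_EndD(2)[OF powA Suc.prems(1)] .
    have "(t [^] k) \<odot>\<^bsub>D\<^esub> ?x = (a [^]\<^bsub>A\<^esub> L) ((t [^] k) \<odot>\<^bsub>D\<^esub> x)"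
      using module_EndD(4)[OF powA t_pow_closed Suc.prems(1)] by simp
    \<comment> \<open>The element t^k x is in the socle, because t^(k+1) x = 0.\<close>
    also have "\<dots> = \<zero>\<^bsub>D\<^esub>"
      using Suc.prems t_closed
      by (intro socle) (simp_all add: D.smult_assoc1[symmetric] P.m_comm)
    finally have "(a [^]\<^bsub>A\<^esub> (k * L)) ?x = \<zero>\<^bsub>D\<^esub>"
      using Suc.IH x' by blast
    moreover have "a [^]\<^bsub>A\<^esub> (Suc k * L) = a [^]\<^bsub>A\<^esub> (k * L) \<otimes>\<^bsub>A\<^esub> a [^]\<^bsub>A\<^esub> L"
      using aA by (simp add: A.nat_pow_mult add.commute)
    ultimately show ?case using Suc.prems(1) by (simp add: module_End_simps(4))
  qed
  \<comment> \<open>Equality as functions also concerns arguments outside the carrier, where both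
    extensional maps are undefined.\<close>
  from this[OF _ tL] have "(a [^]\<^bsub>A\<^esub> (L * L)) x = \<zero>\<^bsub>A\<^esub> x" for x
    using module_EndD(1)[OF powA, of "L * L"]
    by (cases "x \<in> carrier D") (auto simp: module_End_simps(1) extensional_def)
  then show ?thesis by blast
qed

text \<open>\<open>R_pow\<close> demands that a diagonal block be an endomorphism of its summand,
  whereas \<open>diag_radical\<close> records only where its values lie; this bridges the
  two.\<close>

lemma block_closed:
  assumes a: "a \<in> carrier A" and j: "j \<in> S"
  shows "block S N a j j \<in> carrier (module_End P (N j))"
proof (rule module_EndI)
  interpret Nj: module P "N j" using N_module[OF j] .
  note aD = module_EndD[OF a]
  fix x assume x: "x \<in> carrier (N j)"
  show "block S N a j j x \<in> carrier (N j)"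
    using direct_sum_mem[OF aD(2)[OF inj_closed[OF x]] j] x by (simp add: block_def)
  show "block S N a j j (x \<oplus>\<^bsub>N j\<^esub> y) = block S N a j j x \<oplus>\<^bsub>N j\<^esub> block S N a j j y"
    if y: "y \<in> carrier (N j)" for y
  proof -
    have "block S N a j j (x \<oplus>\<^bsub>N j\<^esub> y) = (a (inj j x) \<oplus>\<^bsub>D\<^esub> a (inj j y)) j"
      using x y inj_closed by (simp add: block_def inj_add aD(3))
    then show ?thesis using x y j by (simp add: block_def direct_sum_simps(3))
  qed
  show "block S N a j j (c \<odot>\<^bsub>N j\<^esub> x) = c \<odot>\<^bsub>N j\<^esub> block S N a j j x" if c: "c \<in> carrier P" for c
  proof -
    have "block S N a j j (c \<odot>\<^bsub>N j\<^esub> x) = (c \<odot>\<^bsub>D\<^esub> a (inj j x)) j"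
      using x c inj_closed by (simp add: block_def inj_smult aD(4))
    then show ?thesis using x j by (simp add: block_def direct_sum_simps(4))
  qed
qed (simp add: block_def)

theorem diag_radical_eq_radical: "diag_radical = radical A"
  using radical_subset_diag_radical
    nil_left_ideal_subset_radical[OF left_ideal_diag_radical diag_radical_nilpotent] by blast

end

section \<open>Powers of \<open>R/(t\<^sup>n)\<close> over a principal ideal domain\<close>

lemma quotient_module_simps:
  "carrier (quotient_module R I) = carrier (R Quot I)"
  "\<zero>\<^bsub>quotient_module R I\<^esub> = \<zero>\<^bsub>R Quot I\<^esub>"
  "x \<oplus>\<^bsub>quotient_module R I\<^esub> y = x \<oplus>\<^bsub>R Quot I\<^esub> y"
  "c \<odot>\<^bsub>quotient_module R I\<^esub> x = (I +>\<^bsub>R\<^esub> c) \<otimes>\<^bsub>R Quot I\<^esub> x"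
  by (simp_all add: quotient_module_def)

lemma carrier_Quot: "carrier (R Quot I) = (\<lambda>a. I +>\<^bsub>R\<^esub> a) ` carrier R"
  by (auto simp: FactRing_simps)

lemma zero_Quot: "\<zero>\<^bsub>R Quot I\<^esub> = I"
  by (simp add: FactRing_def)

lemma module_quotient_module:
  assumes "cring R" "ideal I R"
  shows "module R (quotient_module R I)"
proof -
  interpret I: ideal I R by fact
  interpret h: ring_hom_cring R "R Quot I" "(+>\<^bsub>R\<^esub>) I"
    by (rule I.rcos_ring_hom_cring[OF assms(1)])
  show ?thesis
  proof (rule moduleI[OF assms(1)])
    show "abelian_group (quotient_module R I)"
      by (rule abelian_groupI)
        (auto simp: quotient_module_simps h.S.add.m_ac intro: h.S.add.l_inv_ex)
  qed (simp_all add: quotient_module_simps h.S.l_distr h.S.r_distr h.S.m_assoc)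
qed

section \<open>Coprimality to an irreducible element and the rings R/(t^n)\<close>

context principal_domain
begin

text \<open>The ideal of t is maximal, so a and t generate R. Feeding x a + y t = 1 into the term s
  t^n raises the exponent by one and changes only the coefficient of a.\<close>

lemma irreducible_pow_bezout:
  assumes t: "t \<in> carrier R" and irr: "ring_irreducible t" and a: "a \<in> carrier R" "a \<notin> PIdl t"
  shows "\<exists>h\<in>carrier R. \<exists>s\<in>carrier R. h \<otimes> a \<oplus> s \<otimes> t [^] (n::nat) = \<one>"
proof (induction n)
  case 0
  show ?case using a by (intro bexI[of _ \<zero>] bexI[of _ \<one>]) simp_all
next
  case (Suc n)
  then obtain h s where hs: "h \<in> carrier R" "s \<in> carrier R" "h \<otimes> a \<oplus> s \<otimes> t [^] n = \<one>"
    by blast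
  interpret T: maximalideal "PIdl t" R using irreducible_imp_maximalideal[OF t irr] .
  define J where "J = PIdl a <+>\<^bsub>R\<^esub> PIdl t"
  have J_iff: "z \<in> J \<longleftrightarrow> (\<exists>x\<in>carrier R. \<exists>y\<in>carrier R. z = x \<otimes> a \<oplus> y \<otimes> t)" for z
    unfolding J_def set_add_def' cgenideal_def by blast
  have ideal_J: "ideal J R"
    unfolding J_def using add_ideals cgenideal_ideal a t by blast
  have "PIdl t \<subseteq> J"
  proof
    fix z assume "z \<in> PIdl t"
    then obtain y where y: "y \<in> carrier R" "z = y \<otimes> t" unfolding cgenideal_def by blast
    then show "z \<in> J"
      unfolding J_iff using a t by (intro bexI[of _ \<zero>] bexI[of _ y]) simp_all
  qed
  moreover have "a \<in> J"
    unfolding J_iff using a t by (intro bexI[of _ \<one>] bexI[of _ \<zero>]) simp_all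
  ultimately have "J = carrier R"
    using T.I_maximal[OF ideal_J] additive_subgroup.a_subset[OF ideal.axioms(1)[OF ideal_J]] a(2)
    by blast
  then obtain x y where xy: "x \<in> carrier R" "y \<in> carrier R" "x \<otimes> a \<oplus> y \<otimes> t = \<one>"
    using J_iff[of \<one>] by (metis one_closed)
  have "(h \<oplus> s \<otimes> t [^] n \<otimes> x) \<otimes> a \<oplus> (s \<otimes> y) \<otimes> t [^] Suc n
      = h \<otimes> a \<oplus> s \<otimes> t [^] n \<otimes> (x \<otimes> a \<oplus> y \<otimes> t)"
    using hs(1,2) xy(1,2) a(1) t by (simp add: l_distr r_distr m_ac add.m_ac)
  also have "\<dots> = \<one>"
    unfolding xy(3) using hs t by simp
  finally have "(h \<oplus> s \<otimes> t [^] n \<otimes> x) \<otimes> a \<oplus> (s \<otimes> y) \<otimes> t [^] Suc n = \<one>" .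
  moreover have "h \<oplus> s \<otimes> t [^] n \<otimes> x \<in> carrier R" "s \<otimes> y \<in> carrier R"
    using hs(1,2) xy(1,2) t by simp_all
  ultimately show ?case by blast
qed

lemma cgenideal_quotient_eq_zero_iff:
  assumes "c \<in> carrier R" "a \<in> carrier R"
  shows "PIdl c +> a = \<zero>\<^bsub>R Quot PIdl c\<^esub> \<longleftrightarrow> (\<exists>r\<in>carrier R. a = r \<otimes> c)"
proof -
  have I: "ideal (PIdl c) R" by (rule cgenideal_ideal[OF assms(1)])
  show ?thesis
    using ideal.rcos_const_imp_mem[OF I assms(2)] a_rcos_zero[OF I]
    by (auto simp: zero_Quot cgenideal_def)
qed

context
  fixes t and n :: nat
  assumes t: "t \<in> carrier R" and irr: "ring_irreducible t"
begin

abbreviation (input) Q where "Q \<equiv> quotient_module R (PIdl (t [^] n))"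

lemma quotient_pow_hom: "ring_hom_cring R (R Quot PIdl (t [^] n)) ((+>) (PIdl (t [^] n)))"
  using ideal.rcos_ring_hom_cring[OF cgenideal_ideal is_cring] t by simp

lemma quotient_pow_annihilated:
  assumes "y \<in> carrier Q"
  shows "t [^] n \<odot>\<^bsub>Q\<^esub> y = \<zero>\<^bsub>Q\<^esub>"
proof -
  interpret h: ring_hom_cring R "R Quot PIdl (t [^] n)" "(+>) (PIdl (t [^] n))"
    by (rule quotient_pow_hom)
  have "PIdl (t [^] n) +> t [^] n = \<zero>\<^bsub>R Quot PIdl (t [^] n)\<^esub>"
    using t by (subst cgenideal_quotient_eq_zero_iff) (auto intro: bexI[of _ \<one>])
  then show ?thesis
    using assms by (simp add: quotient_module_simps)
qed

text \<open>Lifted to R, the hypothesis reads t^k a = r t^n. Since t is nonzero, being irreducible,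
  t^k cancels in the domain and leaves a = t^(n-k) r.\<close>

lemma quotient_pow_divisible:
  assumes y: "y \<in> carrier Q" and k: "k \<le> n" and zero: "t [^] k \<odot>\<^bsub>Q\<^esub> y = \<zero>\<^bsub>Q\<^esub>"
  shows "y \<in> scal_image Q (t [^] (n - k))"
proof -
  interpret h: ring_hom_cring R "R Quot PIdl (t [^] n)" "(+>) (PIdl (t [^] n))"
    by (rule quotient_pow_hom)
  obtain a where a: "a \<in> carrier R" "y = PIdl (t [^] n) +> a"
    using y by (auto simp: quotient_module_simps carrier_Quot)
  then have "PIdl (t [^] n) +> (t [^] k \<otimes> a) = \<zero>\<^bsub>R Quot PIdl (t [^] n)\<^esub>"
    using zero t by (simp add: quotient_module_simps)
  then obtain r where r: "r \<in> carrier R" "t [^] k \<otimes> a = r \<otimes> t [^] n"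
    using a t by (subst (asm) cgenideal_quotient_eq_zero_iff) auto
  have "t [^] n = t [^] k \<otimes> t [^] (n - k)"
    using k t by (simp add: nat_pow_mult)
  then have "t [^] k \<otimes> a = r \<otimes> (t [^] k \<otimes> t [^] (n - k))"
    using r(2) by argo
  also have "\<dots> = t [^] k \<otimes> (t [^] (n - k) \<otimes> r)"
    using r(1) t by (simp add: m_ac)
  finally have "t [^] k \<otimes> a = t [^] k \<otimes> (t [^] (n - k) \<otimes> r)" .
  moreover have "t [^] k \<noteq> \<zero>"
    using ring_irreducibleE(1)[OF t irr] t by (induction k) (simp_all add: integral_iff)
  ultimately have "a = t [^] (n - k) \<otimes> r"
    using m_lcancel[of "t [^] k" a "t [^] (n - k) \<otimes> r"] a r t by simp
  then have "y = t [^] (n - k) \<odot>\<^bsub>Q\<^esub> (PIdl (t [^] n) +> r)"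
    using a r t by (simp add: quotient_module_simps)
  then show ?thesis
    using r by (auto simp: scal_image_def quotient_module_simps)
qed

text \<open>A representative of y is not a multiple of t, hence is coprime to t^n, and its Bezout
  coefficient becomes the inverse of y.\<close>

lemma quotient_pow_unit:
  assumes y: "y \<in> carrier Q" "y \<notin> scal_image Q t"
  shows "\<exists>u\<in>carrier (R Quot PIdl (t [^] n)). u \<otimes>\<^bsub>R Quot PIdl (t [^] n)\<^esub> y = \<one>\<^bsub>R Quot PIdl (t [^] n)\<^esub>"
proof -
  interpret h: ring_hom_cring R "R Quot PIdl (t [^] n)" "(+>) (PIdl (t [^] n))"
    by (rule quotient_pow_hom)
  obtain a where a: "a \<in> carrier R" "y = PIdl (t [^] n) +> a"
    using y by (auto simp: quotient_module_simps carrier_Quot)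
  have "a \<notin> PIdl t"
  proof
    assume "a \<in> PIdl t"
    then obtain r where r: "r \<in> carrier R" "a = r \<otimes> t" by (auto simp: cgenideal_def)
    then have "y = t \<odot>\<^bsub>Q\<^esub> (PIdl (t [^] n) +> r)"
      using a t by (simp add: quotient_module_simps h.S.m_comm)
    with r y(2) show False by (auto simp: scal_image_def quotient_module_simps)
  qed
  then obtain h s where hs: "h \<in> carrier R" "s \<in> carrier R" "h \<otimes> a \<oplus> s \<otimes> t [^] n = \<one>"
    using irreducible_pow_bezout[OF t irr a(1)] by blast
  have "PIdl (t [^] n) +> (s \<otimes> t [^] n) = \<zero>\<^bsub>R Quot PIdl (t [^] n)\<^esub>"
    using t hs by (subst cgenideal_quotient_eq_zero_iff) auto
  then have "PIdl (t [^] n) +> (h \<otimes> a \<oplus> s \<otimes> t [^] n)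
      = (PIdl (t [^] n) +> h) \<otimes>\<^bsub>R Quot PIdl (t [^] n)\<^esub> y"
    using hs(1,2) a t by (simp del: h.hom_mult add: h.hom_mult[of h a])
  then have "(PIdl (t [^] n) +> h) \<otimes>\<^bsub>R Quot PIdl (t [^] n)\<^esub> y = \<one>\<^bsub>R Quot PIdl (t [^] n)\<^esub>"
    using hs(3) by simp
  with hs(1) show ?thesis by blast
qed

text \<open>Divisibility by t is tested coordinatewise, so some coordinate y_k is a unit, with
  inverse u. The map z -> (u z_k) x, of rank one, sends y to x.\<close>

lemma direct_sum_quotient_pow_transitive:
  fixes T :: "'i set"
  defines "M \<equiv> direct_sum T (\<lambda>_. Q)"
  assumes x: "x \<in> carrier M" and y: "y \<in> carrier M" and not_div: "y \<notin> scal_image M t"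
  shows "\<exists>f\<in>carrier (module_End R M). f y = x"
proof -
  define K where "K = R Quot PIdl (t [^] n)"
  interpret h: ring_hom_cring R K "(+>) (PIdl (t [^] n))"
    unfolding K_def by (rule quotient_pow_hom)
  have mem: "z i \<in> carrier K" if "z \<in> carrier M" "i \<in> T" for z i
    using direct_sum_mem[OF that[unfolded M_def]] by (simp add: quotient_module_simps K_def)
  have ext: "y \<in> extensional T" using direct_sum_extensional y by (auto simp: M_def)
  then obtain k where k: "k \<in> T" "y k \<notin> scal_image Q t"
    using not_div by (auto simp: M_def scal_image_direct_sum)
  then obtain u where u: "u \<in> carrier K" "u \<otimes>\<^bsub>K\<^esub> y k = \<one>\<^bsub>K\<^esub>"
    using quotient_pow_unit[of "y k"] mem[OF y k(1)] by (auto simp: quotient_module_simps K_def)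
  define f where "f = (\<lambda>z\<in>carrier M. \<lambda>i\<in>T. x i \<otimes>\<^bsub>K\<^esub> (u \<otimes>\<^bsub>K\<^esub> z k))"
  interpret M: module R M
    unfolding M_def using t
    by (intro direct_sum_module is_cring module_quotient_module cgenideal_ideal) simp
  have "f \<in> carrier (module_End R M)"
  proof (rule module_EndI)
    show "f z \<in> carrier M" if "z \<in> carrier M" for z
    proof -
      have "x i \<otimes>\<^bsub>K\<^esub> (u \<otimes>\<^bsub>K\<^esub> z k) \<in> carrier K" if "i \<in> T" for i
        using mem[OF x that] mem[OF \<open>z \<in> carrier M\<close> k(1)] u by simp
      then show ?thesis
        using that by (auto simp: f_def) (auto simp: M_def direct_sum_simps quotient_module_simps K_def)
    qed
    show "f (z \<oplus>\<^bsub>M\<^esub> w) = f z \<oplus>\<^bsub>M\<^esub> f w" if "z \<in> carrier M" "w \<in> carrier M" for z w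
    proof -
      have eq: "v \<oplus>\<^bsub>M\<^esub> v' = (\<lambda>i\<in>T. v i \<oplus>\<^bsub>K\<^esub> v' i)" for v v'
        by (simp add: M_def direct_sum_simps quotient_module_simps K_def)
      have "f (z \<oplus>\<^bsub>M\<^esub> w) = (\<lambda>i\<in>T. x i \<otimes>\<^bsub>K\<^esub> (u \<otimes>\<^bsub>K\<^esub> (z k \<oplus>\<^bsub>K\<^esub> w k)))"
        using M.M.a_closed[OF that] k(1) by (simp add: f_def) (simp add: eq)
      also have "\<dots> = (\<lambda>i\<in>T. f z i \<oplus>\<^bsub>K\<^esub> f w i)"
        by (rule restrict_ext)
          (use that u mem[OF x] mem[OF that(1) k(1)] mem[OF that(2) k(1)] in \<open>simp add: f_def h.S.r_distr\<close>)
      finally show ?thesis by (simp only: eq)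
    qed
    show "f (c \<odot>\<^bsub>M\<^esub> z) = c \<odot>\<^bsub>M\<^esub> f z" if c: "c \<in> carrier R" and z: "z \<in> carrier M" for c z
    proof -
      have eq: "c \<odot>\<^bsub>M\<^esub> v = (\<lambda>i\<in>T. (PIdl (t [^] n) +> c) \<otimes>\<^bsub>K\<^esub> v i)" for v
        by (simp add: M_def direct_sum_simps quotient_module_simps K_def)
      have "f (c \<odot>\<^bsub>M\<^esub> z) = (\<lambda>i\<in>T. x i \<otimes>\<^bsub>K\<^esub> (u \<otimes>\<^bsub>K\<^esub> ((PIdl (t [^] n) +> c) \<otimes>\<^bsub>K\<^esub> z k)))"
        using M.smult_closed[OF c z] k(1) by (simp add: f_def) (simp add: eq)
      also have "\<dots> = (\<lambda>i\<in>T. (PIdl (t [^] n) +> c) \<otimes>\<^bsub>K\<^esub> f z i)"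
        by (rule restrict_ext)
          (use c z u mem[OF x] mem[OF z k(1)] in \<open>simp add: f_def h.S.m_ac\<close>)
      finally show ?thesis by (simp only: eq)
    qed
  qed (simp add: f_def)
  moreover have "f y = x"
  proof (rule direct_sum_eqI[of _ T "\<lambda>_. Q"])
    show "f y \<in> carrier (direct_sum T (\<lambda>_. Q))"
      using module_EndD(2)[OF calculation y] by (simp add: M_def)
    show "f y i = x i" if "i \<in> T" for i
      using y u mem[OF x that] that by (simp add: f_def)
  qed (use x M_def in simp)
  ultimately show ?thesis by blast
qed

end

text \<open>Annihilation and divisibility pass from R/(t^n) to its powers coordinate by coordinate.
  Transitivity mixes coordinates and rests on the rank one maps instead.\<close>

lemma homogeneous_sum_quotients:
  assumes t: "t \<in> carrier R" and irr: "ring_irreducible t"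
    and S: "finite S" and pos: "\<And>j. j \<in> S \<Longrightarrow> 0 < l j" and inj: "inj_on l S"
  shows "homogeneous_sum R t S
    (\<lambda>j. direct_sum (T j) (\<lambda>_. quotient_module R (PIdl (t [^] l j)))) l"
proof (intro homogeneous_sum.intro homogeneous_sum_axioms.intro is_cring t S pos inj)
  fix j y assume y: "y \<in> carrier (direct_sum (T j) (\<lambda>_. quotient_module R (PIdl (t [^] l j))))"
  show "t [^] l j \<odot>\<^bsub>direct_sum (T j) (\<lambda>_. quotient_module R (PIdl (t [^] l j)))\<^esub> y
      = \<zero>\<^bsub>direct_sum (T j) (\<lambda>_. quotient_module R (PIdl (t [^] l j)))\<^esub>"
    unfolding direct_sum_simps
    by (rule restrict_ext) (rule quotient_pow_annihilated[OF t irr direct_sum_mem[OF y]])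
  fix k assume k: "k \<le> l j"
    and zero: "t [^] k \<odot>\<^bsub>direct_sum (T j) (\<lambda>_. quotient_module R (PIdl (t [^] l j)))\<^esub> y
      = \<zero>\<^bsub>direct_sum (T j) (\<lambda>_. quotient_module R (PIdl (t [^] l j)))\<^esub>"
  have "y i \<in> scal_image (quotient_module R (PIdl (t [^] l j))) (t [^] (l j - k))"
    if "i \<in> T j" for i
    using quotient_pow_divisible[OF t irr direct_sum_mem[OF y that] k] fun_cong[OF zero, of i] that
    by (simp add: direct_sum_simps)
  then show "y \<in> scal_image (direct_sum (T j) (\<lambda>_. quotient_module R (PIdl (t [^] l j)))) (t [^] (l j - k))"
    using direct_sum_extensional[OF y] by (auto simp: scal_image_direct_sum)
next
  fix j
  show "module R (direct_sum (T j) (\<lambda>_. quotient_module R (PIdl (t [^] l j))))"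
    using t by (intro direct_sum_module is_cring module_quotient_module cgenideal_ideal) simp
qed (assumption, rule direct_sum_quotient_pow_transitive[OF t irr])

end

section \<open>Specialisation to E[t] with t = X\<close>

lemma R_part_eq_diag_radical:
  assumes "homogeneous_sum (poly_ring E) X\<^bsub>E\<^esub> {1..r} (\<lambda>j. E_pow E (l j) (m j)) l"
  shows "R_part E r l m =
    homogeneous_sum.diag_radical (poly_ring E) X\<^bsub>E\<^esub> {1..r} (\<lambda>j. E_pow E (l j) (m j))"
proof -
  let ?N = "\<lambda>j. E_pow E (l j) (m j)"
  interpret homogeneous_sum "poly_ring E" "X\<^bsub>E\<^esub>" "{1..r}" ?N l by fact
  \<comment> \<open>The inclusion of images in \<open>R_pow\<close> is unfolded into a condition on
    each x, the form used by \<open>diag_radical\<close>.\<close>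
  have "block {1..r} ?N a j j ` carrier (?N j) \<subseteq> (\<lambda>x. X\<^bsub>E\<^esub> \<odot>\<^bsub>?N j\<^esub> x) ` carrier (?N j)
      \<longleftrightarrow> (\<forall>x\<in>carrier (?N j). a (inj j x) j \<in> scal_image (?N j) X\<^bsub>E\<^esub>)" for a j
    by (auto simp: block_def scal_image_def)
  with block_closed show ?thesis
    unfolding R_part_def R_pow_def diag_radical_def M_part_def E_part_def by auto
qed

theorem mainTheorem3:
  fixes K :: "('a, 'b) ring_scheme" and p :: "'a list"
    and r :: nat and l m :: "nat \<Rightarrow> nat"
  assumes "perfect_field K"
    and "p \<in> carrier (poly_ring K)" and "pirreducible\<^bsub>K\<^esub> (carrier K) p"
    and "\<forall>j\<in>{1..r}. 0 < l j" and "strict_mono_on {1..r} l"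
    and "\<forall>j\<in>{1..r}. 0 < m j"
  shows "R_part (Rupt\<^bsub>K\<^esub> (carrier K) p) r l m = radical (M_part (Rupt\<^bsub>K\<^esub> (carrier K) p) r l m)"
proof -
  define E where "E = Rupt\<^bsub>K\<^esub> (carrier K) p"
  interpret K: field K using assms(1) by (simp add: perfect_field_def)
  interpret E: field E
    unfolding E_def using K.rupture_is_field_iff_pirreducible[OF K.carrier_is_subfield assms(2)] assms(3)
    by simp
  interpret P: principal_domain "poly_ring E"
    by (rule E.univ_poly_is_principal[OF E.carrier_is_subfield])
  have X: "X\<^bsub>E\<^esub> \<in> carrier (poly_ring E)"
    by (rule E.var_closed(1)[OF E.carrier_is_subring])
  \<comment> \<open>Irreducibility of p makes E a field; over a field, X is irreducible because it
    has degree one.\<close>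
  moreover have "pirreducible\<^bsub>E\<^esub> (carrier E) X\<^bsub>E\<^esub>"
    by (rule E.degree_one_imp_pirreducible[OF E.carrier_is_subfield X]) (simp add: var_def)
  ultimately have "homogeneous_sum (poly_ring E) X\<^bsub>E\<^esub> {1..r} (\<lambda>j. E_pow E (l j) (m j)) l"
    unfolding E_pow_def using assms(4,5)
    by (intro P.homogeneous_sum_quotients) (auto dest: strict_mono_on_imp_inj_on)
  from R_part_eq_diag_radical[OF this] homogeneous_sum.diag_radical_eq_radical[OF this]
  show ?thesis
    unfolding E_def[symmetric] M_part_def E_part_def by simp
qed

end
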